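(* Let $X$ be a geodesic metric measure space with doubling measure $\mu$ (doubling constant $C_\mu$), and let $\Omega\subset X$ be an open connected set. (i) For every compact connected $K\Subset\Omega$ there is a constant $C>0$, independent of $f$ (but depending among other parameters on $C_\mu$), such that every nonnegative strongly harmonic function $f$ in $\Omega$ satisfies $\sup_K f\le C\inf_K f$. (ii) Let $f$ be a nonnegative weakly harmonic function in $\Omega$ and $K\Subset\Omega$ compact and connected. If $0<r^\Omega_m\le r^\Omega_M<\infty$, $\operatorname{dist}(K,\partial\Omega)>2r^K_M$, and both $r^\Omega_m$ and $3r^\Omega_M$ are admissible radii for all $y\in K$, then $\sup_K f\le C\inf_K f$ with a constant $C=C(C_\mu,r^\Omega_m,r^\Omega_M)$.
   Context: Standing assumptions: $\mu$ is Borel regular, $0<\mu(B)<\infty$ for every ball $B$, and $X$ is proper. $B(x,r)$ is the open ball; $A\Subset\Omega$ means that the closure of $A$ is a compact subset of $\Omega$. $\mu$ is doubling if $\mu(B(x,2r))\le C_\mu\mu(B(x,r))$ for all balls. $X$ is geodesic if any two points are joined by a curve of length equal to their distance. A locally integrable $f:\Omega\to\mathbb{R}$ is strongly harmonic in $\Omega$ if $f(x)=\frac{1}{\mu(B(x,r))}\int_{B(x,r)}f\,d\mu$ for all $x\in\Omega$, $r>0$ with $B(x,r)\Subset\Omega$. It is weakly harmonic if for every $x\in\Omega$ there is a non-empty, at most countable set $\{r^x_1,r^x_2,\ldots\}$ of positive radii (admissible radii at $x$) with $B(x,r^x_i)\Subset\Omega$ and the mean value identity holding on each $B(x,r^x_i)$.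 Put $r^x_M=\sup_i r^x_i$, $r^x_m=\inf_i r^x_i$, and for a set $E$, $r^E_M=\sup_{x\in E}r^x_M$, $r^E_m=\inf_{x\in E}r^x_m$.
   Formalization: In (ii) C also depends on an upper bound for diam K, since dependence on C_μ, r_m, r_M alone fails (a weighted real line gives a counterexample); "admissible" for r_m and 3r_M means the mean value property holds on that ball, as 3r_M cannot be one of the selected radii. *)

theory Defs
  imports "HOL-Analysis.Analysis"
begin

text \<open>
  A metric space is given by an explicit carrier \<open>M\<close> and distance \<open>d\<close>, so that one statement can
  quantify over all metric measure spaces; \<open>mball x r\<close> is the open ball.  Suprema and infima of
  radii, distances and function values are taken in the extended reals, so that
  \<open>sup {} = -\<infinity>\<close>, \<open>inf {} = \<infinity>\<close> and unbounded sets get infinite values.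
\<close>

context Metric_space
begin

definition compactly_inside :: "'a set \<Rightarrow> 'a set \<Rightarrow> bool" where
  "compactly_inside A \<Omega> \<longleftrightarrow>
     compactin mtopology (mtopology closure_of A) \<and> mtopology closure_of A \<subseteq> \<Omega>"

definition proper :: bool where
  "proper \<longleftrightarrow> (\<forall>S. closedin mtopology S \<and> mbounded S \<longrightarrow> compactin mtopology S)"

definition curve_length :: "(real \<Rightarrow> 'a) \<Rightarrow> ereal" where
  "curve_length \<gamma> =
     (SUP (n, t) \<in> {(n :: nat, t :: nat \<Rightarrow> real). mono_on {..n} t \<and> t ` {..n} \<subseteq> {0..1}}.
        ereal (\<Sum>i<n. d (\<gamma> (t i)) (\<gamma> (t (Suc i)))))"

definition geodesic :: bool where
  "geodesic \<longleftrightarrow> (\<forall>x\<in>M. \<forall>y\<in>M. \<exists>\<gamma>. pathin mtopology \<gamma> \<and> \<gamma> 0 = x \<and> \<gamma> 1 = y \<and>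
                   curve_length \<gamma> = ereal (d x y))"

definition set_dist :: "'a set \<Rightarrow> 'a set \<Rightarrow> ereal" where
  "set_dist A B = (INF x\<in>A. INF y\<in>B. ereal (d x y))"

end

text \<open>
  The measure need not live on the Borel \<open>\<sigma>\<close>-algebra exactly: Borel regularity allows larger
  \<open>\<sigma>\<close>-algebras, e.g. the Caratheodory measurable sets of a Borel regular outer measure.
\<close>

locale metric_measure_space = Metric_space M d
  for M :: "'a set" and d :: "'a \<Rightarrow> 'a \<Rightarrow> real" +
  fixes \<mu> :: "'a measure"
  assumes space_eq: "space \<mu> = M"
    and open_measurable: "\<And>U. openin mtopology U \<Longrightarrow> U \<in> sets \<mu>"
    and Borel_regular: "\<And>A. A \<in> sets \<mu> \<Longrightarrow>
          \<exists>B \<in> sigma_sets M {U. openin mtopology U}. A \<subseteq> B \<and> emeasure \<mu> A = emeasure \<mu> B"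
    and ball_measure: "\<And>x r. x \<in> M \<Longrightarrow> 0 < r \<Longrightarrow>
          0 < emeasure \<mu> (mball x r) \<and> emeasure \<mu> (mball x r) < \<infinity>"
    and proper: "proper"
begin

definition doubling :: "real \<Rightarrow> bool" where
  "doubling C \<longleftrightarrow>
     (\<forall>x\<in>M. \<forall>r>0. measure \<mu> (mball x (2 * r)) \<le> C * measure \<mu> (mball x r))"

definition locally_integrable :: "'a set \<Rightarrow> ('a \<Rightarrow> real) \<Rightarrow> bool" where
  "locally_integrable \<Omega> f \<longleftrightarrow>
     (\<forall>A. compactin mtopology A \<and> A \<subseteq> \<Omega> \<longrightarrow> set_integrable \<mu> A f)"

definition mean_value_at :: "('a \<Rightarrow> real) \<Rightarrow> 'a \<Rightarrow> real \<Rightarrow> bool" where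
  "mean_value_at f x r \<longleftrightarrow>
     f x = 1 / measure \<mu> (mball x r) * (LINT y:mball x r|\<mu>. f y)"

definition strongly_harmonic :: "'a set \<Rightarrow> ('a \<Rightarrow> real) \<Rightarrow> bool" where
  "strongly_harmonic \<Omega> f \<longleftrightarrow> locally_integrable \<Omega> f \<and>
     (\<forall>x\<in>\<Omega>. \<forall>r>0. compactly_inside (mball x r) \<Omega> \<longrightarrow> mean_value_at f x r)"

definition admissible_radius :: "'a set \<Rightarrow> ('a \<Rightarrow> real) \<Rightarrow> 'a \<Rightarrow> real \<Rightarrow> bool" where
  "admissible_radius \<Omega> f x r \<longleftrightarrow>
     0 < r \<and> compactly_inside (mball x r) \<Omega> \<and> mean_value_at f x r"

text \<open>
  \<open>R x\<close> is the set \<open>{r\<^sup>x\<^sub>1, r\<^sup>x\<^sub>2, \<dots>}\<close> of radii selected at \<open>x\<close>.  It is kept explicit because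
  \<open>sup_radius\<close> and \<open>inf_radius\<close> below depend on the selection.
\<close>

definition radii_selection :: "'a set \<Rightarrow> ('a \<Rightarrow> real) \<Rightarrow> ('a \<Rightarrow> real set) \<Rightarrow> bool" where
  "radii_selection \<Omega> f R \<longleftrightarrow>
     (\<forall>x\<in>\<Omega>. R x \<noteq> {} \<and> countable (R x) \<and> (\<forall>r\<in>R x. admissible_radius \<Omega> f x r))"

definition weakly_harmonic :: "'a set \<Rightarrow> ('a \<Rightarrow> real) \<Rightarrow> bool" where
  "weakly_harmonic \<Omega> f \<longleftrightarrow> locally_integrable \<Omega> f \<and> (\<exists>R. radii_selection \<Omega> f R)"

end

definition sup_radius :: "('a \<Rightarrow> real set) \<Rightarrow> 'a set \<Rightarrow> ereal" where
  "sup_radius R E = (SUP x\<in>E. SUP r\<in>R x. ereal r)"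

definition inf_radius :: "('a \<Rightarrow> real set) \<Rightarrow> 'a set \<Rightarrow> ereal" where
  "inf_radius R E = (INF x\<in>E. INF r\<in>R x. ereal r)"

locale geodesic_doubling_space = metric_measure_space M d \<mu>
  for M :: "'a set" and d :: "'a \<Rightarrow> 'a \<Rightarrow> real" and \<mu> :: "'a measure" +
  fixes C\<mu> :: real
  assumes geodesic: "geodesic"
    and doubling: "doubling C\<mu>"

end

theory Submission
  imports Defs
begin

text \<open>
  If \<open>f\<close> has the mean value property on the balls \<open>B(y, s) \<subseteq> B(x, t)\<close>, then nonnegativity and
  doubling give \<open>f y \<le> A * f x\<close> for \<open>d x y < s\<close>.  Any two points of the connected set \<open>K\<close> are
  joined by a chain in \<open>K\<close> with steps shorter than \<open>s\<close>.  In a shortest such chain the points with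
  even index are \<open>s\<close>-separated, so doubling bounds its length in terms of \<open>C\<mu>\<close>, \<open>s\<close> and the
  diameter of \<open>K\<close> alone, and iterating the one-step estimate along it gives the Harnack inequality.
\<close>

text \<open>Dividing by \<open>C\<close> makes each \<open>f y / C\<close> a lower bound of
  \<open>f\<close> on \<open>K\<close>, hence at most the infimum. In the extended reals this also
  covers empty \<open>K\<close>, where the supremum is \<open>-\<infinity>\<close> and the infimum
  \<open>\<infinity>\<close>.\<close>

lemma SUP_le_mult_INF_ereal:
  fixes f :: "'a \<Rightarrow> real"
  assumes "0 < C" "\<And>x y. x \<in> K \<Longrightarrow> y \<in> K \<Longrightarrow> f y \<le> C * f x"
  shows "(SUP x\<in>K. ereal (f x)) \<le> ereal C * (INF x\<in>K. ereal (f x))"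
proof (rule SUP_least)
  fix y assume y: "y \<in> K"
  have "ereal (f y / C) \<le> (INF x\<in>K. ereal (f x))"
    using assms y by (intro INF_greatest) (simp add: divide_le_eq mult.commute)
  then have "ereal C * ereal (f y / C) \<le> ereal C * (INF x\<in>K. ereal (f x))"
    using assms(1) by (intro ereal_mult_left_mono) auto
  then show "ereal (f y) \<le> ereal C * (INF x\<in>K. ereal (f x))"
    using assms(1) by simp
qed

section \<open>Step chains in connected sets, and balls compactly inside an open set\<close>

context Metric_space
begin

text \<open>As a relation, its powers \<open>step_rel K r ^^ n\<close> are the chains with exactly
  \<open>n\<close> steps. Chains stay in \<open>K\<close> because the mean value property with
  common radii will be available at points of \<open>K\<close>.\<close>

definition step_rel :: "'a set \<Rightarrow> real \<Rightarrow> ('a \<times> 'a) set" where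
  "step_rel K r = {(x, y). x \<in> K \<and> y \<in> K \<and> d x y < r}"

text \<open>Otherwise the \<open>r\<close>-neighbourhoods of the reachable and of the unreachable
  points of \<open>K\<close> are open sets that cover \<open>K\<close>, both meet it and have no
  common point in it, which contradicts connectedness.\<close>

lemma connectedin_imp_step_chain:
  assumes "connectedin mtopology K" "0 < r" "x \<in> K" "y \<in> K"
  shows "(x, y) \<in> (step_rel K r)\<^sup>*"
proof (rule ccontr)
  assume no: "(x, y) \<notin> (step_rel K r)\<^sup>*"
  have KM: "K \<subseteq> M"
    using assms(1) by (auto simp: connectedin_def)
  define S where "S = {z\<in>K. (x, z) \<in> (step_rel K r)\<^sup>*}"
  define U where "U = (\<Union>z\<in>S. mball z r)"
  define V where "V = (\<Union>z\<in>K - S. mball z r)"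
  have closed: "w \<in> S" if "z \<in> S" "w \<in> K" "d z w < r" for z w
    using that unfolding S_def step_rel_def by (auto intro: rtrancl_into_rtrancl)
  have "openin mtopology U" "openin mtopology V"
    unfolding U_def V_def by auto
  moreover have "K \<subseteq> U \<union> V"
    unfolding U_def V_def using KM assms(2) by (auto simp: in_mball)
  moreover have "U \<inter> V \<inter> K = {}"
  proof -
    \<comment> \<open>A common point \<open>w\<close> in \<open>K\<close> would be one step from the
      reachable \<open>z\<close>, and \<open>z'\<close> one step from \<open>w\<close>, so
      \<open>z'\<close> would be reachable too.\<close>
    have "w \<notin> K" if "z \<in> S" "z' \<in> K - S" "w \<in> mball z r" "w \<in> mball z' r" for w z z'
      using that closed[of z w] closed[of w z'] by (auto simp: in_mball commute)
    then show ?thesis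
      unfolding U_def V_def by blast
  qed
  moreover have xy: "x \<in> mball x r" "y \<in> mball y r"
    using assms KM by auto
  moreover have "x \<in> U \<inter> K"
    using xy(1) assms(3) by (auto simp: U_def S_def)
  moreover have "y \<in> V \<inter> K"
    using xy(2) assms(4) no by (auto simp: V_def S_def)
  ultimately show False
    using assms(1) unfolding connectedin by blast
qed

text \<open>If \<open>p i\<close> and \<open>p j\<close> were closer than \<open>r\<close>, one step
  could replace the \<open>j - i \<ge> 2\<close> steps between them, and the chain would become
  strictly shorter.\<close>

lemma shortest_chain_separated:
  assumes least: "\<And>m. m < n \<Longrightarrow> (x, y) \<notin> step_rel K r ^^ m"
    and p: "p 0 = x" "p n = y" "\<And>i. i < n \<Longrightarrow> (p i, p (Suc i)) \<in> step_rel K r"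
    and "i + 2 \<le> j" "j \<le> n"
  shows "r \<le> d (p i) (p j)"
proof (rule ccontr)
  assume "\<not> r \<le> d (p i) (p j)"
  moreover have "p i \<in> K" "p j \<in> K"
    using p(3)[of i] p(3)[of "j - 1"] assms(5,6) by (auto simp: step_rel_def)
  ultimately have "(p i, p j) \<in> step_rel K r"
    by (auto simp: step_rel_def)
  moreover have "(x, p i) \<in> step_rel K r ^^ i"
    unfolding relpow_fun_conv using p assms(5,6) by (intro exI[of _ p]) auto
  moreover have "(p j, y) \<in> step_rel K r ^^ (n - j)"
    unfolding relpow_fun_conv using p assms(5,6) by (intro exI[of _ "\<lambda>k. p (j + k)"]) auto
  ultimately have "(x, y) \<in> step_rel K r ^^ (Suc i + (n - j))"
    unfolding relpow_add by auto
  moreover have "Suc i + (n - j) < n"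
    using assms(5,6) by linarith
  ultimately show False
    using least by blast
qed

text \<open>The radius is half a Lebesgue number of the one-element cover \<open>{\<Omega>}\<close>;
  halving passes from open to closed balls.\<close>

lemma compactin_uniform_mcball_subset:
  assumes "compactin mtopology K" "openin mtopology \<Omega>" "K \<subseteq> \<Omega>"
  obtains r where "0 < r" "\<And>x. x \<in> K \<Longrightarrow> mcball x r \<subseteq> \<Omega>"
proof -
  obtain e where e: "e > 0" "\<And>x. x \<in> K \<Longrightarrow> \<exists>U\<in>{\<Omega>}. mball x e \<subseteq> U"
    using lebesgue_number[of K "{\<Omega>}"] assms by auto
  show thesis
  proof (rule that[of "e / 2"])
    show "0 < e / 2"
      using e(1) by simp
    show "mcball x (e / 2) \<subseteq> \<Omega>" if "x \<in> K" for x
      using e(2)[OF that] e(1) by (fastforce simp: in_mball in_mcball)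
  qed
qed

text \<open>The closure of the open ball lies in the closed ball, so it is closed and bounded, and
  properness makes it compact.\<close>

lemma proper_compactly_inside_mball:
  assumes "proper" "mcball x r \<subseteq> \<Omega>"
  shows "compactly_inside (mball x r) \<Omega>"
proof -
  have sub: "mtopology closure_of mball x r \<subseteq> mcball x r"
    by (simp add: closure_of_minimal mball_subset_mcball)
  then have "mbounded (mtopology closure_of mball x r)"
    using mbounded_mcball mbounded_subset by blast
  then show ?thesis
    using assms sub unfolding compactly_inside_def proper_def by auto
qed

lemma compactly_inside_imp_subset:
  assumes "A \<subseteq> M" "compactly_inside A \<Omega>"
  shows "A \<subseteq> \<Omega>"
  using assms closure_of_subset[of A mtopology] by (auto simp: compactly_inside_def)

end

section \<open>Doubling, packing and the length of chains\<close>

context metric_measure_space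
begin

lemma sets_mball [measurable]: "mball x r \<in> sets \<mu>"
  by (simp add: open_measurable)

text \<open>Balls with a centre outside \<open>M\<close> or a nonpositive radius are empty, so the
  statement and the monotonicity of ball measures carry no side conditions.\<close>

lemma fmeasurable_mball: "mball x r \<in> fmeasurable \<mu>"
proof (cases "x \<in> M \<and> 0 < r")
  case True
  then show ?thesis
    using ball_measure by (simp add: fmeasurable_def)
next
  case False
  then have "mball x r = {}"
    using mball_eq_empty[of x r] by auto
  then show ?thesis
    by simp
qed

lemma measure_mball_pos: "x \<in> M \<Longrightarrow> 0 < r \<Longrightarrow> 0 < measure \<mu> (mball x r)"
  using ball_measure[of x r] by (simp add: measure_def enn2real_positive_iff less_top)

lemma measure_mball_mono:
  "mball x r \<subseteq> mball y s \<Longrightarrow> measure \<mu> (mball x r) \<le> measure \<mu> (mball y s)"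
  by (intro measure_mono_fmeasurable fmeasurable_mball sets_mball)

lemma doubling_iterate:
  assumes "doubling C" "0 \<le> C" "x \<in> M" "0 < r"
  shows "measure \<mu> (mball x (2 ^ k * r)) \<le> C ^ k * measure \<mu> (mball x r)"
proof (induction k)
  case (Suc k)
  have "measure \<mu> (mball x (2 * (2 ^ k * r))) \<le> C * measure \<mu> (mball x (2 ^ k * r))"
    using assms by (simp add: doubling_def)
  also have "\<dots> \<le> C * (C ^ k * measure \<mu> (mball x r))"
    using Suc assms(2) by (rule mult_left_mono)
  finally show ?case
    by (simp add: mult.assoc)
qed simp

text \<open>The first ball lies in the ball about \<open>y\<close> of radius
  \<open>d x y + s\<close>, which \<open>k\<close> doublings of \<open>r\<close> cover. This
  compares balls with different centres.\<close>

lemma measure_mball_le_doubling: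
  assumes "doubling C" "0 \<le> C" "x \<in> M" "y \<in> M" "0 < r" "d x y + s \<le> 2 ^ k * r"
  shows "measure \<mu> (mball x s) \<le> C ^ k * measure \<mu> (mball y r)"
proof -
  have "mball x s \<subseteq> mball y (2 ^ k * r)"
    using assms by (intro mball_subset) (auto simp: commute)
  then have "measure \<mu> (mball x s) \<le> measure \<mu> (mball y (2 ^ k * r))"
    by (rule measure_mball_mono)
  also have "\<dots> \<le> C ^ k * measure \<mu> (mball y r)"
    using assms by (intro doubling_iterate)
  finally show ?thesis .
qed

text \<open>Packing: the balls of radius \<open>r / 2\<close> about the separated points are
  disjoint and lie in one large ball \<open>B\<close>, while doubling gives each of them at least
  the fraction \<open>1 / C ^ k\<close> of the measure of \<open>B\<close>.\<close>

lemma card_separated_le: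
  assumes "doubling C" "0 \<le> C" "0 < r" "x \<in> M"
    and fin: "finite I" and p: "\<And>i. i \<in> I \<Longrightarrow> p i \<in> M" "\<And>i. i \<in> I \<Longrightarrow> d x (p i) \<le> \<delta>"
    and sep: "\<And>i j. i \<in> I \<Longrightarrow> j \<in> I \<Longrightarrow> i \<noteq> j \<Longrightarrow> r \<le> d (p i) (p j)"
    and "0 \<le> \<delta>" and k: "2 * \<delta> + r \<le> 2 ^ k * (r / 2)"
  shows "real (card I) \<le> C ^ k"
proof -
  define B where "B = mball x (\<delta> + r)"
  have Bpos: "0 < measure \<mu> B"
    unfolding B_def using assms by (intro measure_mball_pos) auto
  have disj: "disjoint_family_on (\<lambda>i. mball (p i) (r / 2)) I"
    unfolding disjoint_family_on_def
  proof (intro ballI impI)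
    fix i j assume ij: "i \<in> I" "j \<in> I" "i \<noteq> j"
    show "mball (p i) (r / 2) \<inter> mball (p j) (r / 2) = {}"
    proof (rule ccontr)
      assume "mball (p i) (r / 2) \<inter> mball (p j) (r / 2) \<noteq> {}"
      then obtain z where "z \<in> M" "d (p i) z < r / 2" "d (p j) z < r / 2"
        by (auto simp: in_mball)
      then show False
        using sep[OF ij] triangle[of "p i" z "p j"] p(1) ij by (simp add: commute)
    qed
  qed
  have "(\<Sum>i\<in>I. measure \<mu> (mball (p i) (r / 2))) = measure \<mu> (\<Union>i\<in>I. mball (p i) (r / 2))"
    using fmeasurableD2[OF fmeasurable_mball]
    by (intro measure_finite_Union[symmetric] fin disj) auto
  also have "\<dots> \<le> measure \<mu> B"
  proof (rule measure_mono_fmeasurable)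
    show "(\<Union>i\<in>I. mball (p i) (r / 2)) \<subseteq> B"
    proof (rule UN_least)
      fix i assume "i \<in> I"
      then show "mball (p i) (r / 2) \<subseteq> B"
        unfolding B_def using p assms(3,4)
        by (intro mball_subset) (auto simp: commute[of "p i"] intro: add_mono)
    qed
    show "(\<Union>i\<in>I. mball (p i) (r / 2)) \<in> sets \<mu>"
      using fin by (intro sets.finite_UN) auto
  qed (simp add: B_def fmeasurable_mball)
  finally have sum_le: "(\<Sum>i\<in>I. measure \<mu> (mball (p i) (r / 2))) \<le> measure \<mu> B" .
  \<comment> \<open>The distance of the centres, at most \<delta>, and the radius
    \<open>\<delta> + r\<close> of \<open>B\<close> add up to at most
    \<open>2 * \<delta> + r\<close>, the left side of hypothesis \<open>k\<close>.\<close>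
  have "measure \<mu> B \<le> C ^ k * measure \<mu> (mball (p i) (r / 2))" if "i \<in> I" for i
    unfolding B_def using p(1)[OF that] p(2)[OF that] assms
    by (intro measure_mball_le_doubling) auto
  then have "real (card I) * measure \<mu> B \<le> (\<Sum>i\<in>I. C ^ k * measure \<mu> (mball (p i) (r / 2)))"
    by (rule sum_bounded_below)
  also have "\<dots> = C ^ k * (\<Sum>i\<in>I. measure \<mu> (mball (p i) (r / 2)))"
    by (simp add: sum_distrib_left)
  also have "\<dots> \<le> C ^ k * measure \<mu> B"
    using sum_le assms(2) by (intro mult_left_mono) auto
  finally show ?thesis
    using Bpos by simp
qed

text \<open>Neighbouring points of a chain are less than \<open>r\<close> apart, so the packing
  bound is applied to every second point of a shortest chain. The resulting bound on the length does
  not depend on \<open>x\<close> and \<open>y\<close>.\<close>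

lemma bounded_step_chain:
  assumes "doubling C" "0 \<le> C" "0 < r" "connectedin mtopology K"
    and diam: "\<And>x y. x \<in> K \<Longrightarrow> y \<in> K \<Longrightarrow> d x y \<le> \<delta>"
    and k: "2 * \<delta> + r \<le> 2 ^ k * (r / 2)" and "x \<in> K" "y \<in> K"
  obtains n where "real n \<le> 2 * C ^ k" "(x, y) \<in> step_rel K r ^^ n"
proof -
  have KM: "K \<subseteq> M"
    using assms(4) by (auto simp: connectedin_def)
  have ex: "\<exists>n. (x, y) \<in> step_rel K r ^^ n"
    using connectedin_imp_step_chain assms by (auto simp: rtrancl_power)
  define n where "n = (LEAST n. (x, y) \<in> step_rel K r ^^ n)"
  have n: "(x, y) \<in> step_rel K r ^^ n"
    unfolding n_def using ex by (rule LeastI_ex)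
  have least: "(x, y) \<notin> step_rel K r ^^ m" if "m < n" for m
    using that unfolding n_def by (rule not_less_Least)
  obtain p where p: "p 0 = x" "p n = y" "\<And>i. i < n \<Longrightarrow> (p i, p (Suc i)) \<in> step_rel K r"
    using n unfolding relpow_fun_conv by blast
  have pK: "p i \<in> K" if "i \<le> n" for i
    using that p(1) p(3)[of "i - 1"] \<open>x \<in> K\<close> by (cases "i = 0") (auto simp: step_rel_def)
  have sep: "r \<le> d (p (2 * i)) (p (2 * j))" if "i \<le> n div 2" "j \<le> n div 2" "i < j" for i j
    using that by (intro shortest_chain_separated[OF least p]) auto
  \<comment> \<open>There are \<open>n div 2 + 1\<close> even indices up to \<open>n\<close>, and
    \<open>n \<le> 2 * (n div 2 + 1)\<close>.\<close>
  have "real (card {..n div 2}) \<le> C ^ k"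
  proof (rule card_separated_le[where p = "\<lambda>i. p (2 * i)" and x = x and \<delta> = \<delta> and r = r])
    fix i assume i: "i \<in> {..n div 2}"
    then have "p (2 * i) \<in> K"
      by (intro pK) auto
    then show "p (2 * i) \<in> M" "d x (p (2 * i)) \<le> \<delta>"
      using KM diam \<open>x \<in> K\<close> by auto
    fix j assume "j \<in> {..n div 2}" "i \<noteq> j"
    then show "r \<le> d (p (2 * i)) (p (2 * j))"
      using sep[of i j] sep[of j i] i by (cases "i < j") (auto simp: commute)
  next
    show "0 \<le> \<delta>"
      using diam[OF \<open>x \<in> K\<close> \<open>x \<in> K\<close>] nonneg[of x x] by linarith
  qed (use assms KM in auto)
  then have "real n \<le> 2 * C ^ k"
    by simp
  then show thesis
    using n that by blast
qed

section \<open>Harnack estimates from the mean value property\<close>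

text \<open>Both sides are integrals of \<open>f\<close> over the respective balls, and enlarging
  the ball can only increase the integral of a nonnegative function.\<close>

lemma mean_value_comparison:
  assumes "locally_integrable \<Omega> f" and f0: "\<And>z. z \<in> \<Omega> \<Longrightarrow> 0 \<le> f z" and "x \<in> M" "y \<in> M"
    and x: "admissible_radius \<Omega> f x t" and y: "admissible_radius \<Omega> f y s"
    and sub: "mball y s \<subseteq> mball x t"
  shows "measure \<mu> (mball y s) * f y \<le> measure \<mu> (mball x t) * f x"
proof -
  have eq: "measure \<mu> (mball z u) * f z = (LINT w:mball z u|\<mu>. f w)"
    if "admissible_radius \<Omega> f z u" "z \<in> M" for z u
    using that measure_mball_pos[of z u]
    by (simp add: admissible_radius_def mean_value_at_def)
  have cin: "compactly_inside (mball x t) \<Omega>"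
    using x by (simp add: admissible_radius_def)
  have sub_cl: "mball x t \<subseteq> mtopology closure_of mball x t"
    by (simp add: closure_of_subset mball_subset_mspace)
  \<comment> \<open>Local integrability speaks of compact sets, so integrability on the ball is
    inherited from its compact closure.\<close>
  have "set_integrable \<mu> (mtopology closure_of mball x t) f"
    using assms(1) cin by (simp add: locally_integrable_def compactly_inside_def)
  then have int: "set_integrable \<mu> (mball x t) f"
    by (rule set_integrable_subset[OF _ sets_mball sub_cl])
  have pos: "0 \<le> f z" if "z \<in> mball x t" for z
    using that f0 compactly_inside_imp_subset[OF mball_subset_mspace cin] by blast
  have "(LINT w:mball y s|\<mu>. f w) \<le> (LINT w:mball x t|\<mu>. f w)"
    using set_integrable_subset[OF int sets_mball sub] int sub pos
    unfolding set_lebesgue_integral_def set_integrable_def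
    by (intro integral_mono) (auto simp: indicator_def)
  then show ?thesis
    using eq x y assms(3,4) by simp
qed

text \<open>The first distance condition puts the ball about \<open>y\<close> inside the ball about
  \<open>x\<close>; the second puts the ball about \<open>x\<close> inside the ball about
  \<open>y\<close> of radius \<open>2 ^ k * s\<close>, so the two measures differ by at most the
  factor \<open>C ^ k\<close>.\<close>

lemma harnack_step:
  assumes "doubling C" "0 \<le> C" "locally_integrable \<Omega> f" "\<And>z. z \<in> \<Omega> \<Longrightarrow> 0 \<le> f z"
    and "x \<in> M" "y \<in> M" "0 \<le> f x"
    and x: "admissible_radius \<Omega> f x t" and y: "admissible_radius \<Omega> f y s"
    and "d x y + s \<le> t" "d x y + t \<le> 2 ^ k * s"
  shows "f y \<le> C ^ k * f x"
proof -
  have s: "0 < s"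
    using y by (simp add: admissible_radius_def)
  have "mball y s \<subseteq> mball x t"
    using assms by (intro mball_subset) (auto simp: commute)
  then have "measure \<mu> (mball y s) * f y \<le> measure \<mu> (mball x t) * f x"
    using assms by (intro mean_value_comparison)
  also have "\<dots> \<le> C ^ k * measure \<mu> (mball y s) * f x"
    using assms s by (intro mult_right_mono measure_mball_le_doubling) auto
  finally show ?thesis
    using measure_mball_pos[OF \<open>y \<in> M\<close> s] by (simp add: mult.commute mult.left_commute)
qed

text \<open>Both Harnack inequalities are instances: all that is used of harmonicity is a pair of
  admissible radii common to all points of \<open>K\<close>. The numbers \<open>k\<close>,
  \<open>j\<close> and \<open>N\<close> are fixed by \<delta>, the two radii and \<open>C\<close>,
  so the constant is the same for all \<open>f\<close>.\<close>

theorem harnack_two_radii: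
  assumes "doubling C" "1 \<le> C" "connectedin mtopology K"
    and diam: "\<And>x y. x \<in> K \<Longrightarrow> y \<in> K \<Longrightarrow> d x y \<le> \<delta>"
    and "compactly_inside K \<Omega>" "locally_integrable \<Omega> f" "\<And>z. z \<in> \<Omega> \<Longrightarrow> 0 \<le> f z"
    and adm: "\<And>y. y \<in> K \<Longrightarrow> admissible_radius \<Omega> f y s"
      "\<And>y. y \<in> K \<Longrightarrow> admissible_radius \<Omega> f y t"
    and s: "0 < s" "2 * s \<le> t" "s + t \<le> 2 ^ k * s"
    and j: "2 * \<delta> + s \<le> 2 ^ j * (s / 2)" and N: "2 * C ^ j \<le> real N"
  shows "(SUP x\<in>K. ereal (f x)) \<le> ereal ((C ^ k) ^ N) * (INF x\<in>K. ereal (f x))"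
proof (rule SUP_le_mult_INF_ereal)
  show "0 < (C ^ k) ^ N"
    using assms(2) by simp
next
  fix x y assume xy: "x \<in> K" "y \<in> K"
  have KM: "K \<subseteq> M"
    using assms(3) by (auto simp: connectedin_def)
  then have K\<Omega>: "K \<subseteq> \<Omega>"
    using assms(5) by (rule compactly_inside_imp_subset)
  \<comment> \<open>For \<open>d z w < s\<close>, the bounds \<open>2 * s \<le> t\<close> and
    \<open>s + t \<le> 2 ^ k * s\<close> yield the two distance conditions of
    \<open>harnack_step\<close>.\<close>
  have step: "f w \<le> C ^ k * f z" if "(z, w) \<in> step_rel K s" for z w
    using that assms KM K\<Omega>
    by (intro harnack_step[where \<Omega> = \<Omega> and s = s and t = t]) (auto simp: step_rel_def)
  have chain: "f w \<le> (C ^ k) ^ n * f x" if "(x, w) \<in> step_rel K s ^^ n" for n w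
    using that
  proof (induction n arbitrary: w)
    case (Suc n)
    then obtain z where z: "(x, z) \<in> step_rel K s ^^ n" "(z, w) \<in> step_rel K s"
      by auto
    have "f w \<le> C ^ k * f z"
      using step z(2) .
    also have "\<dots> \<le> C ^ k * ((C ^ k) ^ n * f x)"
      using Suc.IH[OF z(1)] assms(2) by (intro mult_left_mono) auto
    finally show ?case
      by (simp add: mult.assoc)
  qed simp
  obtain n where n: "real n \<le> 2 * C ^ j" "(x, y) \<in> step_rel K s ^^ n"
    by (rule bounded_step_chain[OF assms(1) _ s(1) assms(3) diam j xy]) (use assms(2) in auto)
  have "f y \<le> (C ^ k) ^ n * f x"
    using chain n(2) .
  \<comment> \<open>As \<open>1 \<le> C\<close> and \<open>f x\<close> is nonnegative, the exponent
    can be raised to \<open>N\<close>, which removes the dependence on the pair of points.\<close>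
  also have "\<dots> \<le> (C ^ k) ^ N * f x"
    using n(1) N assms(2,7) xy K\<Omega> by (intro mult_right_mono power_increasing) auto
  finally show "f y \<le> (C ^ k) ^ N * f x" .
qed

lemma doubling_mono: "doubling C \<Longrightarrow> C \<le> D \<Longrightarrow> doubling D"
  unfolding doubling_def by (meson measure_nonneg mult_right_mono order_trans)

end

section \<open>Choice of the constants and the two Harnack inequalities\<close>

lemma ex_le_power2_mult:
  fixes a b :: real
  assumes "0 < b"
  shows "\<exists>k :: nat. a \<le> 2 ^ k * b"
proof -
  obtain k :: nat where "a / b < 2 ^ k"
    using real_arch_pow[of 2 "a / b"] by auto
  then show ?thesis
    using assms by (intro exI[of _ k]) (simp add: divide_less_eq)
qed

theorem corollary4p2:
  shows "(\<forall>(X :: 'a set) d \<mu> C\<mu> \<Omega> K.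
      geodesic_doubling_space X d \<mu> C\<mu> \<and>
      openin (Metric_space.mtopology X d) \<Omega> \<and>
      connectedin (Metric_space.mtopology X d) \<Omega> \<and>
      compactin (Metric_space.mtopology X d) K \<and>
      connectedin (Metric_space.mtopology X d) K \<and>
      Metric_space.compactly_inside X d K \<Omega>
      \<longrightarrow> (\<exists>C>0. \<forall>f :: 'a \<Rightarrow> real.
            metric_measure_space.strongly_harmonic X d \<mu> \<Omega> f \<and> (\<forall>x\<in>\<Omega>. 0 \<le> f x)
            \<longrightarrow> (SUP x\<in>K. ereal (f x)) \<le> ereal C * (INF x\<in>K. ereal (f x))))
    \<and>
    (\<forall>C\<mu> r\<^sub>m r\<^sub>M \<delta> :: real. 0 < r\<^sub>m \<and> r\<^sub>m \<le> r\<^sub>M \<longrightarrow> (\<exists>C>0.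
      \<forall>(X :: 'a set) d \<mu> \<Omega> K (f :: 'a \<Rightarrow> real) R.
        geodesic_doubling_space X d \<mu> C\<mu> \<and>
        openin (Metric_space.mtopology X d) \<Omega> \<and>
        connectedin (Metric_space.mtopology X d) \<Omega> \<and>
        compactin (Metric_space.mtopology X d) K \<and>
        connectedin (Metric_space.mtopology X d) K \<and>
        Metric_space.compactly_inside X d K \<Omega> \<and>
        (\<forall>x\<in>K. \<forall>y\<in>K. d x y \<le> \<delta>) \<and>
        metric_measure_space.weakly_harmonic X d \<mu> \<Omega> f \<and>
        metric_measure_space.radii_selection X d \<mu> \<Omega> f R \<and>
        (\<forall>x\<in>\<Omega>. 0 \<le> f x) \<and>
        inf_radius R \<Omega> = ereal r\<^sub>m \<and>
        sup_radius R \<Omega> = ereal r\<^sub>M \<and>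
        Metric_space.set_dist d K (Metric_space.mtopology X d frontier_of \<Omega>)
          > 2 * sup_radius R K \<and>
        (\<forall>y\<in>K. metric_measure_space.admissible_radius X d \<mu> \<Omega> f y r\<^sub>m \<and>
               metric_measure_space.admissible_radius X d \<mu> \<Omega> f y (3 * r\<^sub>M))
        \<longrightarrow> (SUP x\<in>K. ereal (f x)) \<le> ereal C * (INF x\<in>K. ereal (f x))))"
proof (intro conjI allI impI)
  fix X :: "'a set" and d \<mu> C\<mu> \<Omega> K
  assume asm: "geodesic_doubling_space X d \<mu> C\<mu> \<and>
      openin (Metric_space.mtopology X d) \<Omega> \<and>
      connectedin (Metric_space.mtopology X d) \<Omega> \<and>
      compactin (Metric_space.mtopology X d) K \<and>
      connectedin (Metric_space.mtopology X d) K \<and>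
      Metric_space.compactly_inside X d K \<Omega>"
  then interpret geodesic_doubling_space X d \<mu> C\<mu>
    by blast
  have K: "openin mtopology \<Omega>" "compactin mtopology K" "connectedin mtopology K"
    "compactly_inside K \<Omega>"
    using asm by auto
  have K\<Omega>: "K \<subseteq> \<Omega>"
    using compactin_subset_topspace[OF K(2)] K(4) by (simp add: compactly_inside_imp_subset)
  obtain \<rho> where \<rho>: "0 < \<rho>" "\<And>x. x \<in> K \<Longrightarrow> mcball x \<rho> \<subseteq> \<Omega>"
    using compactin_uniform_mcball_subset[OF K(2,1) K\<Omega>] by blast
  obtain \<delta> where \<delta>: "\<And>x y. x \<in> K \<Longrightarrow> y \<in> K \<Longrightarrow> d x y \<le> \<delta>"
    using compactin_imp_mbounded[OF K(2)] unfolding mbounded_alt by blast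
  obtain j :: nat where j: "2 * \<delta> + \<rho> / 2 \<le> 2 ^ j * (\<rho> / 2 / 2)"
    using ex_le_power2_mult \<rho>(1) by (metis half_gt_zero)
  \<comment> \<open>\<open>D\<close> is again a doubling constant, and being at least 1 it has
    monotone powers; \<open>N\<close> rounds the bound on the chain length up to a natural
    number.\<close>
  define D where "D = max 1 C\<mu>"
  define N where "N = nat \<lceil>2 * D ^ j\<rceil>"
  \<comment> \<open>Strong harmonicity then makes every positive radius up to \<rho> admissible at
    every point of \<open>K\<close>, in particular \<open>\<rho> / 2\<close> and \<rho>.\<close>
  have inside: "compactly_inside (mball x u) \<Omega>" if "x \<in> K" "u \<le> \<rho>" for x u
    using \<rho>(2)[OF that(1)] mcball_subset_concentric[OF that(2), of x]
    by (intro proper_compactly_inside_mball proper) auto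
  show "\<exists>C>0. \<forall>f :: 'a \<Rightarrow> real. strongly_harmonic \<Omega> f \<and> (\<forall>x\<in>\<Omega>. 0 \<le> f x)
      \<longrightarrow> (SUP x\<in>K. ereal (f x)) \<le> ereal C * (INF x\<in>K. ereal (f x))"
  \<comment> \<open>With \<open>s = \<rho> / 2\<close> and \<open>t = \<rho>\<close> the exponent 2
    suffices, since \<open>s + t = 3 * s \<le> 2 ^ 2 * s\<close>.\<close>
  proof (intro exI[of _ "(D ^ 2) ^ N"] conjI allI impI)
    show "0 < (D ^ 2) ^ N"
      by (simp add: D_def)
    fix f :: "'a \<Rightarrow> real"
    assume f: "strongly_harmonic \<Omega> f \<and> (\<forall>x\<in>\<Omega>. 0 \<le> f x)"
    show "(SUP x\<in>K. ereal (f x)) \<le> ereal ((D ^ 2) ^ N) * (INF x\<in>K. ereal (f x))"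
    proof (rule harnack_two_radii[where s = "\<rho> / 2" and t = \<rho> and \<delta> = \<delta> and j = j and \<Omega> = \<Omega>])
      show "doubling D"
        using doubling by (rule doubling_mono) (simp add: D_def)
      show "2 * D ^ j \<le> real N"
        by (simp add: N_def real_nat_ceiling_ge)
      show "admissible_radius \<Omega> f y (\<rho> / 2)" "admissible_radius \<Omega> f y \<rho>" if "y \<in> K" for y
        using f that K\<Omega> \<rho>(1) inside by (auto simp: strongly_harmonic_def admissible_radius_def)
    qed (use f K \<delta> j \<rho>(1) in \<open>auto simp: strongly_harmonic_def D_def\<close>)
  qed
next
  fix C\<mu> r\<^sub>m r\<^sub>M \<delta> :: real
  assume r: "0 < r\<^sub>m \<and> r\<^sub>m \<le> r\<^sub>M"
  \<comment> \<open>All constants are chosen before the space, \<open>K\<close> and \<open>f\<close>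
    are introduced, so they depend only on \<open>C\<mu>\<close>, \<open>r\<^sub>m\<close>,
    \<open>r\<^sub>M\<close> and the diameter bound \<delta>.\<close>
  obtain j :: nat where j: "2 * \<delta> + r\<^sub>m \<le> 2 ^ j * (r\<^sub>m / 2)"
    using ex_le_power2_mult r by (metis half_gt_zero)
  obtain k :: nat where k: "r\<^sub>m + 3 * r\<^sub>M \<le> 2 ^ k * r\<^sub>m"
    using ex_le_power2_mult r by blast
  define D where "D = max 1 C\<mu>"
  define N where "N = nat \<lceil>2 * D ^ j\<rceil>"
  show "\<exists>C>0.
      \<forall>(X :: 'a set) d \<mu> \<Omega> K (f :: 'a \<Rightarrow> real) R.
        geodesic_doubling_space X d \<mu> C\<mu> \<and>
        openin (Metric_space.mtopology X d) \<Omega> \<and>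
        connectedin (Metric_space.mtopology X d) \<Omega> \<and>
        compactin (Metric_space.mtopology X d) K \<and>
        connectedin (Metric_space.mtopology X d) K \<and>
        Metric_space.compactly_inside X d K \<Omega> \<and>
        (\<forall>x\<in>K. \<forall>y\<in>K. d x y \<le> \<delta>) \<and>
        metric_measure_space.weakly_harmonic X d \<mu> \<Omega> f \<and>
        metric_measure_space.radii_selection X d \<mu> \<Omega> f R \<and>
        (\<forall>x\<in>\<Omega>. 0 \<le> f x) \<and>
        inf_radius R \<Omega> = ereal r\<^sub>m \<and>
        sup_radius R \<Omega> = ereal r\<^sub>M \<and>
        Metric_space.set_dist d K (Metric_space.mtopology X d frontier_of \<Omega>)
          > 2 * sup_radius R K \<and>
        (\<forall>y\<in>K. metric_measure_space.admissible_radius X d \<mu> \<Omega> f y r\<^sub>m \<and>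
               metric_measure_space.admissible_radius X d \<mu> \<Omega> f y (3 * r\<^sub>M))
        \<longrightarrow> (SUP x\<in>K. ereal (f x)) \<le> ereal C * (INF x\<in>K. ereal (f x))"
  proof (intro exI[of _ "(D ^ k) ^ N"] conjI allI impI)
    show "0 < (D ^ k) ^ N"
      by (simp add: D_def)
    fix X :: "'a set" and d \<mu> \<Omega> K and f :: "'a \<Rightarrow> real" and R
    assume asm: "geodesic_doubling_space X d \<mu> C\<mu> \<and>
        openin (Metric_space.mtopology X d) \<Omega> \<and>
        connectedin (Metric_space.mtopology X d) \<Omega> \<and>
        compactin (Metric_space.mtopology X d) K \<and>
        connectedin (Metric_space.mtopology X d) K \<and>
        Metric_space.compactly_inside X d K \<Omega> \<and>
        (\<forall>x\<in>K. \<forall>y\<in>K. d x y \<le> \<delta>) \<and>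
        metric_measure_space.weakly_harmonic X d \<mu> \<Omega> f \<and>
        metric_measure_space.radii_selection X d \<mu> \<Omega> f R \<and>
        (\<forall>x\<in>\<Omega>. 0 \<le> f x) \<and>
        inf_radius R \<Omega> = ereal r\<^sub>m \<and>
        sup_radius R \<Omega> = ereal r\<^sub>M \<and>
        Metric_space.set_dist d K (Metric_space.mtopology X d frontier_of \<Omega>)
          > 2 * sup_radius R K \<and>
        (\<forall>y\<in>K. metric_measure_space.admissible_radius X d \<mu> \<Omega> f y r\<^sub>m \<and>
               metric_measure_space.admissible_radius X d \<mu> \<Omega> f y (3 * r\<^sub>M))"
    then interpret geodesic_doubling_space X d \<mu> C\<mu>
      by blast
    show "(SUP x\<in>K. ereal (f x)) \<le> ereal ((D ^ k) ^ N) * (INF x\<in>K. ereal (f x))"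
    \<comment> \<open>The two radii are the ones given as admissible on \<open>K\<close>;
      \<open>2 * r\<^sub>m \<le> 3 * r\<^sub>M\<close> follows from
      \<open>0 < r\<^sub>m \<le> r\<^sub>M\<close>.\<close>
    proof (rule harnack_two_radii[where s = r\<^sub>m and t = "3 * r\<^sub>M" and \<delta> = \<delta> and j = j and \<Omega> = \<Omega>])
      show "doubling D"
        using doubling by (rule doubling_mono) (simp add: D_def)
      show "2 * D ^ j \<le> real N"
        by (simp add: N_def real_nat_ceiling_ge)
    qed (use asm r j k in \<open>auto simp: weakly_harmonic_def D_def\<close>)
  qed
qed

end
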